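(* Any two distinct elements in $IA_n$ either generate a free group or a free abelian group. More precisely, let $\chi_{i,j}$ and $\chi_{i',j'}$ be two distinct elements in $IA_n$. Then $\chi_{i,j}$ and $\chi_{i',j'}$ generate (1) a free abelian group, when $\{i,j\}\cap\{i',j'\}=\emptyset$, or $j=j'$ and $i\neq i'$; (2) a free group, otherwise.
   Context: $F(X_n)$ is the free group of rank $n$ on generators $x_1,\dots,x_n$, and $IA_n$ is the group of automorphisms of $F(X_n)$ which induce the identity automorphism on the abelianization $F(X_n)/[F(X_n),F(X_n)]\cong\mathbb{Z}^n$. For $1\le i,j\le n$ with $i\neq j$, $\chi_{i,j}\in IA_n$ is the automorphism of $F(X_n)$ with $\chi_{i,j}(x_i)=x_j^{-1}x_ix_j$ and $\chi_{i,j}(x_k)=x_k$ for $k\neq i$.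
   Formalization: The opening sentence is false for arbitrary elements of IA_n (n = 3: conjugation by x_2, and the automorphism x_2 -> x_2[x_1,x_3] fixing x_1, x_3); it is read, as the "More precisely" part makes it, for the elements chi_{i,j} only. *)

theory Defs
  imports "HOL-Algebra.Algebra"
begin

section \<open>Free groups as groups of reduced words\<close>

text \<open>The letter \<open>(x, True)\<close> stands for the generator \<open>x\<close>, and \<open>(x, False)\<close> for its inverse.\<close>

type_synonym 'a letter = "'a \<times> bool"

definition flip :: "'a letter \<Rightarrow> 'a letter" where
  "flip l = (fst l, \<not> snd l)"

definition reduced :: "'a letter list \<Rightarrow> bool" where
  "reduced w \<longleftrightarrow> successively (\<lambda>k l. l \<noteq> flip k) w"

definition red_cons :: "'a letter \<Rightarrow> 'a letter list \<Rightarrow> 'a letter list" where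
  "red_cons l w = (if w \<noteq> [] \<and> hd w = flip l then tl w else l # w)"

definition normalize_word :: "'a letter list \<Rightarrow> 'a letter list" where
  "normalize_word w = foldr red_cons w []"

definition free_group :: "'a set \<Rightarrow> 'a letter list monoid" where
  "free_group S = \<lparr>carrier = {w. reduced w \<and> fst ` set w \<subseteq> S},
     monoid.mult = (\<lambda>v w. normalize_word (v @ w)), one = []\<rparr>"

definition free_gen :: "'a \<Rightarrow> 'a letter list" where
  "free_gen x = [(x, True)]"

text \<open>The homomorphism from a free group to \<open>G\<close> that extends a map \<open>f\<close> on the generators.\<close>

definition letter_val :: "('b, 'c) monoid_scheme \<Rightarrow> ('a \<Rightarrow> 'b) \<Rightarrow> 'a letter \<Rightarrow> 'b" where
  "letter_val G f l = (if snd l then f (fst l) else inv\<^bsub>G\<^esub> (f (fst l)))"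

definition free_ext :: "('b, 'c) monoid_scheme \<Rightarrow> ('a \<Rightarrow> 'b) \<Rightarrow> 'a letter list \<Rightarrow> 'b" where
  "free_ext G f w = foldr (\<lambda>l y. letter_val G f l \<otimes>\<^bsub>G\<^esub> y) w \<one>\<^bsub>G\<^esub>"

text \<open>In both definitions the basis may be taken inside the group itself, so letting \<open>S\<close> range
  over sets of the element type of \<open>G\<close> is no restriction.\<close>

definition is_free_group :: "('a, 'b) monoid_scheme \<Rightarrow> bool" where
  "is_free_group G \<longleftrightarrow> (\<exists>S :: 'a set. G \<cong> free_group S)"

definition is_free_abelian_group :: "('a, 'b) monoid_scheme \<Rightarrow> bool" where
  "is_free_abelian_group G \<longleftrightarrow> (\<exists>S :: 'a set. G \<cong> free_Abelian_group S)"


section \<open>The groups \<open>IA\<^sub>n\<close> and the automorphisms \<open>\<chi>\<^sub>i\<^sub>,\<^sub>j\<close>\<close>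

text \<open>An endomorphism \<open>\<phi>\<close> induces on \<open>F / [F, F]\<close> the map sending the coset of \<open>x\<close> to that of \<open>\<phi> x\<close>.\<close>

definition trivial_on_abelianization :: "('a, 'b) monoid_scheme \<Rightarrow> ('a \<Rightarrow> 'a) \<Rightarrow> bool" where
  "trivial_on_abelianization F \<phi> \<longleftrightarrow>
     (\<forall>x \<in> carrier F. derived F (carrier F) #>\<^bsub>F\<^esub> \<phi> x = derived F (carrier F) #>\<^bsub>F\<^esub> x)"

abbreviation F_X :: "nat \<Rightarrow> nat letter list monoid" where
  "F_X n \<equiv> free_group {1..n}"

definition IA :: "nat \<Rightarrow> (nat letter list \<Rightarrow> nat letter list) monoid" where
  "IA n = AutoGroup (F_X n) \<lparr>carrier := {\<phi> \<in> auto (F_X n). trivial_on_abelianization (F_X n) \<phi>}\<rparr>"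

text \<open>Elements of \<open>AutoGroup\<close> are extensional functions, hence the restriction to the carrier.\<close>

definition chi :: "nat \<Rightarrow> nat \<Rightarrow> nat \<Rightarrow> nat letter list \<Rightarrow> nat letter list" where
  "chi n i j = restrict
     (free_ext (F_X n) (\<lambda>k. if k = i
        then inv\<^bsub>F_X n\<^esub> (free_gen j) \<otimes>\<^bsub>F_X n\<^esub> free_gen i \<otimes>\<^bsub>F_X n\<^esub> free_gen j
        else free_gen k))
     (carrier (F_X n))"


section \<open>Well-definedness\<close>

lemma flip_flip [simp]: "flip (flip l) = l"
  by (simp add: flip_def)

lemma fst_flip [simp]: "fst (flip l) = fst l"
  by (simp add: flip_def)

lemma flip_eq_iff: "flip k = l \<longleftrightarrow> k = flip l"
  by auto

lemma reduced_Nil [simp]: "reduced []"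
  by (simp add: reduced_def)

lemma reduced_Cons: "reduced (l # w) \<longleftrightarrow> (w = [] \<or> hd w \<noteq> flip l) \<and> reduced w"
  by (auto simp: reduced_def successively_Cons)

lemma reduced_red_cons: "reduced w \<Longrightarrow> reduced (red_cons l w)"
  by (cases w) (auto simp: red_cons_def reduced_Cons)

lemma red_cons_flip: "reduced w \<Longrightarrow> red_cons l (red_cons (flip l) w) = w"
  by (cases w) (auto simp: red_cons_def reduced_Cons neq_Nil_conv)

lemma reduced_foldr: "reduced w \<Longrightarrow> reduced (foldr red_cons v w)"
  by (induction v) (auto simp: reduced_red_cons)

lemma reduced_normalize_word [simp]: "reduced (normalize_word w)"
  by (simp add: normalize_word_def reduced_foldr)

lemma normalize_word_reduced: "reduced w \<Longrightarrow> normalize_word w = w"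
  by (induction w) (auto simp: normalize_word_def reduced_Cons red_cons_def)

lemma normalize_word_append: "normalize_word (v @ w) = foldr red_cons v (normalize_word w)"
  by (simp add: normalize_word_def)

lemma foldr_red_cons:
  assumes "reduced w"
  shows "foldr red_cons (red_cons l v) w = red_cons l (foldr red_cons v w)"
proof (cases "v \<noteq> [] \<and> hd v = flip l")
  case True
  then obtain u where "v = flip l # u"
    by (cases v) auto
  then show ?thesis
    using red_cons_flip[OF reduced_foldr[OF assms], of l u] by (simp add: red_cons_def[of l "flip l # u"])
qed (auto simp: red_cons_def[of l v])

lemma foldr_normalize_word:
  assumes "reduced w"
  shows "foldr red_cons (normalize_word v) w = foldr red_cons v w"
proof (induction v)
  case (Cons l v)
  have "normalize_word (l # v) = red_cons l (normalize_word v)"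
    by (simp add: normalize_word_def)
  then show ?case using Cons assms by (simp add: foldr_red_cons)
qed (simp add: normalize_word_def)

lemma set_red_cons: "set (red_cons l w) \<subseteq> insert l (set w)"
  by (auto simp: red_cons_def dest: list.set_sel(2))

lemma set_normalize_word: "set (normalize_word w) \<subseteq> set w"
proof (induction w)
  case (Cons l w)
  have "normalize_word (l # w) = red_cons l (normalize_word w)"
    by (simp add: normalize_word_def)
  then show ?case using Cons set_red_cons[of l "normalize_word w"] by auto
qed (simp add: normalize_word_def)

lemma carrier_free_group: "carrier (free_group S) = {w. reduced w \<and> fst ` set w \<subseteq> S}"
  and mult_free_group: "v \<otimes>\<^bsub>free_group S\<^esub> w = normalize_word (v @ w)"
  and one_free_group: "\<one>\<^bsub>free_group S\<^esub> = []"
  by (simp_all add: free_group_def)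

lemma normalize_word_inverse: "reduced u \<Longrightarrow> foldr red_cons (rev (map flip w) @ w) u = u"
proof (induction w arbitrary: u)
  case (Cons l w)
  then show ?case
    using red_cons_flip[of "foldr red_cons w u" "flip l"] by (simp add: reduced_foldr)
qed simp

lemma group_free_group: "group (free_group S)"
proof (rule groupI)
  fix v w assume *: "v \<in> carrier (free_group S)" "w \<in> carrier (free_group S)"
  show "v \<otimes>\<^bsub>free_group S\<^esub> w \<in> carrier (free_group S)"
    using * subset_trans[OF image_mono[OF set_normalize_word[of "v @ w"], of fst], of S]
    by (simp add: carrier_free_group mult_free_group image_Un)
  fix u assume "u \<in> carrier (free_group S)"
  with * show "v \<otimes>\<^bsub>free_group S\<^esub> w \<otimes>\<^bsub>free_group S\<^esub> u =
      v \<otimes>\<^bsub>free_group S\<^esub> (w \<otimes>\<^bsub>free_group S\<^esub> u)"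
    by (simp add: carrier_free_group mult_free_group normalize_word_append[of "normalize_word _"]
        normalize_word_append[of v "normalize_word _"] foldr_normalize_word)
       (simp add: normalize_word_append normalize_word_reduced reduced_foldr)
next
  fix w assume w: "w \<in> carrier (free_group S)"
  show "\<one>\<^bsub>free_group S\<^esub> \<otimes>\<^bsub>free_group S\<^esub> w = w"
    using w by (simp add: carrier_free_group mult_free_group one_free_group normalize_word_reduced)
  have "fst ` set (normalize_word (rev (map flip w))) \<subseteq> fst ` set (rev (map flip w))"
    by (intro image_mono set_normalize_word)
  also have "\<dots> = fst ` set w"
    by (simp add: image_image)
  finally have "normalize_word (rev (map flip w)) \<in> carrier (free_group S)"
    using w by (auto simp: carrier_free_group)
  moreover have "normalize_word (rev (map flip w)) \<otimes>\<^bsub>free_group S\<^esub> w = \<one>\<^bsub>free_group S\<^esub>"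
    using normalize_word_inverse[of "[]" w] normalize_word_reduced[of w] w
    by (simp add: carrier_free_group mult_free_group one_free_group normalize_word_append
        foldr_normalize_word) (simp add: normalize_word_def)
  ultimately show "\<exists>y\<in>carrier (free_group S). y \<otimes>\<^bsub>free_group S\<^esub> w = \<one>\<^bsub>free_group S\<^esub>"
    by blast
qed (simp add: carrier_free_group one_free_group)

lemma free_gen_in_carrier: "x \<in> S \<Longrightarrow> free_gen x \<in> carrier (free_group S)"
  by (simp add: free_gen_def carrier_free_group reduced_Cons)

lemma inv_free_gen: "x \<in> S \<Longrightarrow> inv\<^bsub>free_group S\<^esub> (free_gen x) = [(x, False)]"
  by (rule group.inv_equality[OF group_free_group])
    (auto simp: free_gen_def carrier_free_group mult_free_group one_free_group reduced_Cons
      normalize_word_def red_cons_def flip_def)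

context group
begin

lemma letter_val_closed:
  "f \<in> S \<rightarrow> carrier G \<Longrightarrow> fst l \<in> S \<Longrightarrow> letter_val G f l \<in> carrier G"
  by (auto simp: letter_val_def)

lemma free_ext_closed:
  "f \<in> S \<rightarrow> carrier G \<Longrightarrow> fst ` set w \<subseteq> S \<Longrightarrow> free_ext G f w \<in> carrier G"
  by (induction w) (auto simp: free_ext_def letter_val_closed)

lemma free_ext_append:
  assumes "f \<in> S \<rightarrow> carrier G" "fst ` set v \<subseteq> S" "fst ` set w \<subseteq> S"
  shows "free_ext G f (v @ w) = free_ext G f v \<otimes> free_ext G f w"
  using assms(2)
proof (induction v)
  case Nil
  then show ?case using free_ext_closed[OF assms(1,3)] by (simp add: free_ext_def)
next
  case (Cons l v)
  then have "letter_val G f l \<in> carrier G" "free_ext G f v \<in> carrier G"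
    using letter_val_closed[OF assms(1)] free_ext_closed[OF assms(1)] by auto
  with Cons free_ext_closed[OF assms(1,3)] show ?case
    by (simp add: free_ext_def m_assoc)
qed

lemma letter_val_flip:
  assumes "f \<in> S \<rightarrow> carrier G" "fst l \<in> S"
  shows "letter_val G f l \<otimes> letter_val G f (flip l) = \<one>"
  using assms by (auto simp: letter_val_def flip_def Pi_def)

lemma free_ext_red_cons:
  assumes f: "f \<in> S \<rightarrow> carrier G" and "fst l \<in> S" "fst ` set w \<subseteq> S"
  shows "free_ext G f (red_cons l w) = letter_val G f l \<otimes> free_ext G f w"
proof (cases "w \<noteq> [] \<and> hd w = flip l")
  case True
  then obtain v where v: "w = flip l # v"
    by (cases w) auto
  have "free_ext G f w = letter_val G f (flip l) \<otimes> free_ext G f v"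
    by (simp add: v free_ext_def)
  moreover have "letter_val G f l \<in> carrier G" "letter_val G f (flip l) \<in> carrier G"
    "free_ext G f v \<in> carrier G"
    using assms v by (auto intro!: letter_val_closed[OF f] free_ext_closed[OF f])
  ultimately show ?thesis
    using letter_val_flip[OF f, of l] assms by (simp add: v red_cons_def flip: m_assoc)
qed (auto simp: red_cons_def free_ext_def)

lemma free_ext_normalize_word:
  assumes f: "f \<in> S \<rightarrow> carrier G" and "fst ` set w \<subseteq> S"
  shows "free_ext G f (normalize_word w) = free_ext G f w"
  using assms(2)
proof (induction w)
  case (Cons l w)
  have n: "normalize_word (l # w) = red_cons l (normalize_word w)"
    by (simp add: normalize_word_def)
  have "fst ` set (normalize_word w) \<subseteq> S"
    using Cons.prems set_normalize_word[of w] by auto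
  then show ?case
    using Cons free_ext_red_cons[OF f, of l "normalize_word w"] n by (simp add: free_ext_def)
qed (simp add: normalize_word_def)

lemma free_ext_hom: "f \<in> S \<rightarrow> carrier G \<Longrightarrow> free_ext G f \<in> hom (free_group S) G"
  by (rule homI)
    (auto simp: carrier_free_group mult_free_group free_ext_closed image_Un
      free_ext_append free_ext_normalize_word)

lemma free_ext_free_gen: "f x \<in> carrier G \<Longrightarrow> free_ext G f (free_gen x) = f x"
  by (simp add: free_ext_def free_gen_def letter_val_def)

lemma free_group_hom_eq:
  assumes g: "g \<in> hom (free_group S) G" and h: "h \<in> hom (free_group S) G"
    and eq: "\<And>x. x \<in> S \<Longrightarrow> g (free_gen x) = h (free_gen x)"
    and w: "w \<in> carrier (free_group S)"
  shows "g w = h w"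
proof -
  interpret F: group "free_group S" by (rule group_free_group)
  interpret g: group_hom "free_group S" G g by unfold_locales (rule g)
  interpret h: group_hom "free_group S" G h by unfold_locales (rule h)
  have letter: "[l] \<in> carrier (free_group S) \<and> g [l] = h [l]" if l: "fst l \<in> S" for l
  proof -
    obtain x b where lx: "l = (x, b)" by fastforce
    have "free_gen x \<in> carrier (free_group S)"
      using l lx by (simp add: free_gen_in_carrier)
    then have "g (inv\<^bsub>free_group S\<^esub> free_gen x) = h (inv\<^bsub>free_group S\<^esub> free_gen x)"
      using l lx eq by (simp add: g.hom_inv h.hom_inv)
    then show ?thesis
      using l lx eq inv_free_gen[of x S]
      by (cases b) (auto simp: free_gen_def carrier_free_group reduced_Cons)
  qed
  show ?thesis using w
  proof (induction w)
    case Nil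
    then show ?case using g.hom_one h.hom_one by (simp add: one_free_group)
  next
    case (Cons l w)
    then have w: "w \<in> carrier (free_group S)" and l: "fst l \<in> S"
      by (auto simp: carrier_free_group reduced_Cons)
    have "l # w = [l] \<otimes>\<^bsub>free_group S\<^esub> w"
      using Cons.prems by (simp add: carrier_free_group mult_free_group normalize_word_reduced)
    then show ?case
      using Cons.IH w letter[OF l] by simp
  qed
qed

end

lemma group_IA: "group (IA n)"
proof -
  note One_nat_def [simp del]
  interpret F: group "F_X n" by (rule group_free_group)
  interpret A: group "AutoGroup (F_X n)" by (rule F.AutoGroup)
  have "subgroup {\<phi> \<in> auto (F_X n). trivial_on_abelianization (F_X n) \<phi>} (AutoGroup (F_X n))"
  proof (rule A.subgroupI)
    have 1: "\<one>\<^bsub>AutoGroup (F_X n)\<^esub> = (\<lambda>x \<in> carrier (F_X n). x)"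
      by (simp add: AutoGroup_def BijGroup_def)
    have m: "f \<otimes>\<^bsub>AutoGroup (F_X n)\<^esub> g = compose (carrier (F_X n)) f g"
      if "f \<in> auto (F_X n)" "g \<in> auto (F_X n)" for f g
      using that by (simp add: AutoGroup_def BijGroup_def auto_def)
    have c: "carrier (AutoGroup (F_X n)) = auto (F_X n)"
      by (simp add: AutoGroup_def)
    have cl: "f x \<in> carrier (F_X n)" if "f \<in> auto (F_X n)" "x \<in> carrier (F_X n)" for f x
      using that by (auto simp: auto_def hom_def)
    show "{\<phi> \<in> auto (F_X n). trivial_on_abelianization (F_X n) \<phi>} \<subseteq> carrier (AutoGroup (F_X n))"
      by (auto simp: c)
    show "{\<phi> \<in> auto (F_X n). trivial_on_abelianization (F_X n) \<phi>} \<noteq> {}"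
      using F.id_in_auto by (force simp: trivial_on_abelianization_def)
    fix f assume f: "f \<in> {\<phi> \<in> auto (F_X n). trivial_on_abelianization (F_X n) \<phi>}"
    let ?g = "inv\<^bsub>AutoGroup (F_X n)\<^esub> f"
    have g: "?g \<in> auto (F_X n)" using f A.inv_closed[of f] by (auto simp: c)
    have "trivial_on_abelianization (F_X n) ?g"
      unfolding trivial_on_abelianization_def
    proof
      fix x assume x: "x \<in> carrier (F_X n)"
      have "f \<otimes>\<^bsub>AutoGroup (F_X n)\<^esub> ?g = \<one>\<^bsub>AutoGroup (F_X n)\<^esub>"
        using f by (intro A.r_inv) (auto simp: c)
      then have "compose (carrier (F_X n)) f ?g x = (\<lambda>x \<in> carrier (F_X n). x) x"
        using m[of f ?g] f g 1 by simp
      then have "f (?g x) = x" using x by (simp add: compose_def)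
      then show "derived (F_X n) (carrier (F_X n)) #>\<^bsub>F_X n\<^esub> ?g x =
        derived (F_X n) (carrier (F_X n)) #>\<^bsub>F_X n\<^esub> x"
        using f cl[OF g x] by (auto simp: trivial_on_abelianization_def)
    qed
    with g show "?g \<in> {\<phi> \<in> auto (F_X n). trivial_on_abelianization (F_X n) \<phi>}" by simp
    fix h assume h: "h \<in> {\<phi> \<in> auto (F_X n). trivial_on_abelianization (F_X n) \<phi>}"
    show "f \<otimes>\<^bsub>AutoGroup (F_X n)\<^esub> h \<in> {\<phi> \<in> auto (F_X n). trivial_on_abelianization (F_X n) \<phi>}"
      using f h A.m_closed[of f h] m[of f h] cl
      by (auto simp: c trivial_on_abelianization_def compose_def)
  qed
  then show ?thesis
    unfolding IA_def by (rule A.subgroup_imp_group)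
qed

lemma
  assumes "i \<in> {1..n}" "j \<in> {1..n}" "i \<noteq> j"
  shows chi_in_IA: "chi n i j \<in> carrier (IA n)"
    and chi_same: "chi n i j (free_gen i) =
      inv\<^bsub>F_X n\<^esub> (free_gen j) \<otimes>\<^bsub>F_X n\<^esub> free_gen i \<otimes>\<^bsub>F_X n\<^esub> free_gen j"
    and chi_other: "\<And>k. k \<in> {1..n} \<Longrightarrow> k \<noteq> i \<Longrightarrow> chi n i j (free_gen k) = free_gen k"
proof -
  note One_nat_def [simp del]
  interpret F: group "F_X n" by (rule group_free_group)
  let ?F = "F_X n"
  note fg = free_gen_in_carrier[of _ "{1..n}"]
  define f where "f = (\<lambda>k. if k = i then inv\<^bsub>?F\<^esub> (free_gen j) \<otimes>\<^bsub>?F\<^esub> free_gen i \<otimes>\<^bsub>?F\<^esub> free_gen j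
        else free_gen k)"
  define g where "g = (\<lambda>k. if k = i then free_gen j \<otimes>\<^bsub>?F\<^esub> free_gen i \<otimes>\<^bsub>?F\<^esub> inv\<^bsub>?F\<^esub> (free_gen j)
        else free_gen k)"
  have f: "f \<in> {1..n} \<rightarrow> carrier ?F" and g: "g \<in> {1..n} \<rightarrow> carrier ?F"
    using assms fg by (auto simp: f_def g_def)
  let ?f = "free_ext ?F f" and ?g = "free_ext ?F g"
  have chi: "chi n i j = restrict ?f (carrier ?F)"
    by (simp add: chi_def f_def)
  have fh: "?f \<in> hom ?F ?F" and gh: "?g \<in> hom ?F ?F"
    using F.free_ext_hom f g by auto
  interpret f: group_hom ?F ?F ?f by unfold_locales (rule fh)
  interpret g: group_hom ?F ?F ?g by unfold_locales (rule gh)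
  have fv: "?f (free_gen k) = f k" and gv: "?g (free_gen k) = g k" if "k \<in> {1..n}" for k
    using that f g by (auto intro!: F.free_ext_free_gen)
  show same: "chi n i j (free_gen i) =
      inv\<^bsub>F_X n\<^esub> (free_gen j) \<otimes>\<^bsub>F_X n\<^esub> free_gen i \<otimes>\<^bsub>F_X n\<^esub> free_gen j"
    using assms fg[of i] fv[of i] by (simp add: chi f_def)
  show other: "\<And>k. k \<in> {1..n} \<Longrightarrow> k \<noteq> i \<Longrightarrow> chi n i j (free_gen k) = free_gen k"
    using fg fv by (simp add: chi f_def)
  have fj: "?f (free_gen j) = free_gen j" and gj: "?g (free_gen j) = free_gen j"
    using assms fv gv by (auto simp: f_def g_def)
  have ci: "free_gen i \<in> carrier ?F" and cj: "free_gen j \<in> carrier ?F"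
    using assms fg by auto
  have fi: "?f (free_gen i) = inv\<^bsub>?F\<^esub> (free_gen j) \<otimes>\<^bsub>?F\<^esub> free_gen i \<otimes>\<^bsub>?F\<^esub> free_gen j"
    and gi: "?g (free_gen i) = free_gen j \<otimes>\<^bsub>?F\<^esub> free_gen i \<otimes>\<^bsub>?F\<^esub> inv\<^bsub>?F\<^esub> (free_gen j)"
    using assms fv gv by (auto simp: f_def g_def)
  have conj1: "free_gen j \<otimes>\<^bsub>?F\<^esub> (inv\<^bsub>?F\<^esub> (free_gen j) \<otimes>\<^bsub>?F\<^esub> free_gen i \<otimes>\<^bsub>?F\<^esub> free_gen j) \<otimes>\<^bsub>?F\<^esub>
      inv\<^bsub>?F\<^esub> (free_gen j) = free_gen i"
    and conj2: "inv\<^bsub>?F\<^esub> (free_gen j) \<otimes>\<^bsub>?F\<^esub> (free_gen j \<otimes>\<^bsub>?F\<^esub> free_gen i \<otimes>\<^bsub>?F\<^esub> inv\<^bsub>?F\<^esub> (free_gen j)) \<otimes>\<^bsub>?F\<^esub>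
      free_gen j = free_gen i"
    using ci cj by (simp_all add: F.m_assoc) (simp_all flip: F.m_assoc)
  have idh: "(\<lambda>x. x) \<in> hom ?F ?F" by (auto simp: hom_def)
  have fg_id: "?f (?g x) = x" if "x \<in> carrier ?F" for x
  proof (rule F.free_group_hom_eq[where g = "\<lambda>x. ?f (?g x)" and h = "\<lambda>x. x"])
    show "(\<lambda>x. ?f (?g x)) \<in> hom ?F ?F" by (rule homI) auto
    fix k assume k: "k \<in> {1..n}"
    show "?f (?g (free_gen k)) = free_gen k"
    proof (cases "k = i")
      case True
      then show ?thesis
        using ci cj conj1 conj2 fi fj unfolding gv[OF k] by (simp add: g_def f.hom_inv)
    next
      case False
      then show ?thesis
        using fv[OF k] unfolding gv[OF k] by (simp add: g_def f_def)
    qed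
  qed (use that idh in auto)
  have gf_id: "?g (?f x) = x" if "x \<in> carrier ?F" for x
  proof (rule F.free_group_hom_eq[where g = "\<lambda>x. ?g (?f x)" and h = "\<lambda>x. x"])
    show "(\<lambda>x. ?g (?f x)) \<in> hom ?F ?F" by (rule homI) auto
    fix k assume k: "k \<in> {1..n}"
    show "?g (?f (free_gen k)) = free_gen k"
    proof (cases "k = i")
      case True
      then show ?thesis
        using ci cj conj1 conj2 gi gj unfolding fv[OF k] by (simp add: f_def g.hom_inv)
    next
      case False
      then show ?thesis
        using gv[OF k] unfolding fv[OF k] by (simp add: g_def f_def)
    qed
  qed (use that idh in auto)
  have "bij_betw ?f (carrier ?F) (carrier ?F)"
    by (rule bij_betw_byWitness[where f' = ?g]) (use fg_id gf_id in auto)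
  then have auto: "chi n i j \<in> auto ?F"
    using F.hom_restrict[OF fh] by (simp add: auto_def Bij_def chi)
  let ?N = "derived ?F (carrier ?F)"
  interpret N: normal ?N ?F by (rule F.derived_self_is_normal)
  interpret Q: comm_group "?F Mod ?N" by (rule F.derived_quot_is_comm_group)
  have q: "(\<lambda>x. ?N #>\<^bsub>?F\<^esub> x) \<in> hom ?F (?F Mod ?N)" by (rule N.r_coset_hom_Mod)
  interpret q: group_hom ?F "?F Mod ?N" "\<lambda>x. ?N #>\<^bsub>?F\<^esub> x"
    by unfold_locales (rule q)
  have "?N #>\<^bsub>?F\<^esub> ?f x = ?N #>\<^bsub>?F\<^esub> x" if x: "x \<in> carrier ?F" for x
  proof (rule Q.free_group_hom_eq[OF _ q _ x])
    show "(\<lambda>x. ?N #>\<^bsub>?F\<^esub> ?f x) \<in> hom ?F (?F Mod ?N)"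
      by (rule homI) (use q.hom_closed q.hom_mult in auto)
    fix k assume k: "k \<in> {1..n}"
    have c: "?N #>\<^bsub>?F\<^esub> free_gen i \<in> carrier (?F Mod ?N)" "?N #>\<^bsub>?F\<^esub> free_gen j \<in> carrier (?F Mod ?N)"
      using assms fg q.hom_closed by auto
    have "?N #>\<^bsub>?F\<^esub> (inv\<^bsub>?F\<^esub> (free_gen j) \<otimes>\<^bsub>?F\<^esub> free_gen i \<otimes>\<^bsub>?F\<^esub> free_gen j) = ?N #>\<^bsub>?F\<^esub> free_gen i"
    proof -
      have "?N #>\<^bsub>?F\<^esub> (inv\<^bsub>?F\<^esub> (free_gen j) \<otimes>\<^bsub>?F\<^esub> free_gen i \<otimes>\<^bsub>?F\<^esub> free_gen j) =
          inv\<^bsub>?F Mod ?N\<^esub> (?N #>\<^bsub>?F\<^esub> free_gen j) \<otimes>\<^bsub>?F Mod ?N\<^esub> (?N #>\<^bsub>?F\<^esub> free_gen i)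
            \<otimes>\<^bsub>?F Mod ?N\<^esub> (?N #>\<^bsub>?F\<^esub> free_gen j)"
        using ci cj by (simp only: q.hom_mult q.hom_inv F.m_closed F.inv_closed)
      also have "\<dots> = ?N #>\<^bsub>?F\<^esub> free_gen i"
        using c by (metis Q.m_comm Q.inv_closed Q.m_assoc Q.l_inv Q.r_one)
      finally show ?thesis .
    qed
    then show "?N #>\<^bsub>?F\<^esub> ?f (free_gen k) = ?N #>\<^bsub>?F\<^esub> free_gen k"
      unfolding fv[OF k] by (auto simp only: f_def split: if_split)
  qed
  with auto show "chi n i j \<in> carrier (IA n)"
    by (simp add: IA_def trivial_on_abelianization_def chi)
qed

end

theory Submission
  imports Defs
begin

text \<open>An automorphism in the subgroup generated by two \<open>\<chi>\<close>'s acts on suitable generators by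
  conjugation, and a conjugator that varies multiplicatively with the automorphism detects its
  triviality, because a reduced word commuting with \<open>x\<close> is empty or begins with \<open>x\<^sup>\<plusminus>\<^sup>1\<close>.

  Both \<open>\<chi>\<^sub>i\<^sub>,\<^sub>j\<close> and \<open>\<chi>\<^sub>i\<^sub>,\<^sub>j\<^sub>'\<close> conjugate \<open>x\<^sub>i\<close> by words in the free group on
  \<open>x\<^sub>j, x\<^sub>j\<^sub>'\<close>, which they fix. On the free group on \<open>x\<^sub>i, x\<^sub>j\<close>, the automorphisms \<open>\<chi>\<^sub>i\<^sub>,\<^sub>j\<close> and \<open>\<chi>\<^sub>j\<^sub>,\<^sub>i\<close>
  are inner. A word in \<open>\<chi>\<^sub>i\<^sub>,\<^sub>j\<close> and \<open>\<chi>\<^sub>k\<^sub>,\<^sub>i\<close> conjugates this free group by a power \<open>x\<^sub>j\<^sup>m\<close> and \<open>x\<^sub>k\<close> by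
  \<open>x\<^sub>j\<^sup>m v\<^sup>-\<^sup>1\<close>, where \<open>v\<close> is the word with \<open>\<chi>\<^sub>i\<^sub>,\<^sub>j\<close> and \<open>\<chi>\<^sub>k\<^sub>,\<^sub>i\<close> replaced by \<open>x\<^sub>j\<^sup>-\<^sup>1\<close> and \<open>x\<^sub>i\<close>; if it is
  trivial, then \<open>m = 0\<close> and hence \<open>v = 1\<close>. In the remaining cases each \<open>\<chi>\<close> fixes the two
  generators involved in the action of the other, so they commute, and the actions on \<open>x\<^sub>i\<close> and \<open>x\<^sub>i\<^sub>'\<close>
  recover the two exponents.\<close>

section \<open>Words in free groups\<close>

lemma singleton_in_free_group [simp]: "[l] \<in> carrier (free_group S) \<longleftrightarrow> fst l \<in> S"
  by (simp add: carrier_free_group reduced_Cons)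

lemma inv_singleton_free_group:
  assumes "fst l \<in> S"
  shows "inv\<^bsub>free_group S\<^esub> [l] = [flip l]"
  by (rule group.inv_equality[OF group_free_group])
    (use assms in \<open>auto simp: mult_free_group one_free_group normalize_word_def red_cons_def\<close>)

lemma Cons_in_free_group:
  assumes "l # w \<in> carrier (free_group S)"
  shows "fst l \<in> S" "w \<in> carrier (free_group S)" "l # w = [l] \<otimes>\<^bsub>free_group S\<^esub> w"
  using assms by (auto simp: carrier_free_group mult_free_group normalize_word_reduced reduced_Cons)

text \<open>A nonempty reduced word is its first letter times the rest, and a letter is a generator
  or the inverse of one.\<close>

lemma free_group_induct [consumes 1, case_names one gen mult inv]:
  assumes w: "w \<in> carrier (free_group S)"
    and one: "P []"
    and gen: "\<And>x. x \<in> S \<Longrightarrow> P (free_gen x)"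
    and mult: "\<And>u v. u \<in> carrier (free_group S) \<Longrightarrow> v \<in> carrier (free_group S) \<Longrightarrow>
      P u \<Longrightarrow> P v \<Longrightarrow> P (u \<otimes>\<^bsub>free_group S\<^esub> v)"
    and inv: "\<And>u. u \<in> carrier (free_group S) \<Longrightarrow> P u \<Longrightarrow> P (inv\<^bsub>free_group S\<^esub> u)"
  shows "P w"
  using w
proof (induction w)
  case (Cons l w)
  note l = Cons_in_free_group[OF Cons.prems]
  obtain x b where lx: "l = (x, b)" by fastforce
  have "x \<in> S" using l lx by simp
  then have "P [l]"
    using gen[of x] inv[of "free_gen x"] free_gen_in_carrier[of x S] inv_free_gen[of x S] lx
    by (cases b) (simp_all add: free_gen_def)
  then show ?case
    using l Cons.IH mult[of "[l]" w] by simp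
qed (rule one)

text \<open>Product and unit do not mention the basis, so the smaller free group sits literally
  inside the larger one. Only inverses, whose definition refers to the carrier, have to be
  compared.\<close>

lemma subgroup_free_group:
  assumes "P \<subseteq> T"
  shows "subgroup (carrier (free_group P)) (free_group T)"
proof -
  interpret T: group "free_group T" by (rule group_free_group)
  interpret P: group "free_group P" by (rule group_free_group)
  have sub: "carrier (free_group P) \<subseteq> carrier (free_group T)"
    using assms by (auto simp: carrier_free_group)
  have "inv\<^bsub>free_group T\<^esub> u = inv\<^bsub>free_group P\<^esub> u" if "u \<in> carrier (free_group P)" for u
    using that sub P.l_inv[of u] P.inv_closed[of u]
    by (intro T.inv_equality) (auto simp only: mult_free_group one_free_group)
  then show ?thesis
    using sub P.m_closed P.one_closed P.inv_closed
    by (intro T.subgroupI) (auto simp only: mult_free_group one_free_group)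
qed

section \<open>Word length under reduction and centralizers of a generator\<close>

lemma length_red_cons: "length (red_cons l w) \<le> Suc (length w)"
  by (auto simp: red_cons_def)

lemma length_normalize_word: "length (normalize_word w) \<le> length w"
proof (induction w)
  case (Cons l w)
  then show ?case
    using length_red_cons[of l "normalize_word w"] by (simp add: normalize_word_def)
qed (simp add: normalize_word_def)

text \<open>Each cancellation shortens the word, so equal length means that nothing was
  cancelled.\<close>

lemma normalize_word_eq_if_length:
  "length (normalize_word w) = length w \<Longrightarrow> normalize_word w = w"
proof (induction w)
  case (Cons l w)
  have n: "normalize_word (l # w) = red_cons l (normalize_word w)"
    by (simp add: normalize_word_def)
  have "length (normalize_word w) = length w"
    using Cons.prems length_red_cons[of l "normalize_word w"] length_normalize_word[of w]
    unfolding n by simp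
  then show ?case
    using Cons n by (auto simp: red_cons_def split: if_splits)
qed (simp add: normalize_word_def)

text \<open>If \<open>w\<close> does not begin with \<open>x\<^sup>\<plusminus>\<^sup>1\<close>, then \<open>x w\<close> is reduced, so by length \<open>w x\<close> is reduced as
  well; the two words are then equal letter by letter.\<close>

lemma hd_of_free_gen_centralizer:
  assumes w: "w \<in> carrier (free_group S)" "w \<noteq> []"
    and comm: "w \<otimes>\<^bsub>free_group T\<^esub> free_gen x = free_gen x \<otimes>\<^bsub>free_group T\<^esub> w"
  shows "fst (hd w) = x"
proof (rule ccontr)
  assume x: "fst (hd w) \<noteq> x"
  then have "reduced ((x, True) # w)"
    using w by (auto simp: carrier_free_group reduced_Cons)
  then have eq: "normalize_word (w @ [(x, True)]) = (x, True) # w"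
    using comm by (simp add: mult_free_group free_gen_def normalize_word_reduced)
  then have "normalize_word (w @ [(x, True)]) = w @ [(x, True)]"
    by (intro normalize_word_eq_if_length) simp
  then show False using eq w x by (cases w) auto
qed

lemma free_gen_centralizer_Nil:
  assumes "w \<in> carrier (free_group P)" "x \<notin> P"
    "w \<otimes>\<^bsub>free_group T\<^esub> free_gen x = free_gen x \<otimes>\<^bsub>free_group T\<^esub> w"
  shows "w = []"
proof (rule ccontr)
  assume "w \<noteq> []"
  then have "fst (hd w) \<in> P"
    using assms(1) by (auto simp: carrier_free_group image_subset_iff dest: hd_in_set)
  with \<open>w \<noteq> []\<close> show False
    using hd_of_free_gen_centralizer[OF assms(1) _ assms(3)] assms(2) by auto
qed

text \<open>The exponent sum \<open>?e\<close> is a homomorphism to the integers that sends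
  \<open>x^m\<close> to \<open>m\<close>.\<close>

lemma free_gen_int_pow_eq_Nil:
  assumes "x \<in> S" "free_gen x [^]\<^bsub>free_group S\<^esub> (m :: int) = []"
  shows "m = 0"
proof -
  let ?e = "free_ext integer_group (\<lambda>_. 1)"
  have "?e \<in> hom (free_group S) integer_group"
    by (rule group.free_ext_hom) simp_all
  then have "?e (free_gen x [^]\<^bsub>free_group S\<^esub> m) = ?e (free_gen x) [^]\<^bsub>integer_group\<^esub> m"
    using assms(1) by (intro hom_int_pow free_gen_in_carrier group_free_group) simp_all
  moreover have "?e (free_gen x) = 1"
    by (rule group.free_ext_free_gen) simp_all
  moreover have "?e [] = 0"
    by (simp add: free_ext_def)
  ultimately show ?thesis
    unfolding assms(2) by (metis group_int_pow_integer_group mult.right_neutral)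
qed

lemma (in group) free_ext_one: "free_ext G (\<lambda>_. \<one>) w = \<one>"
  by (induction w) (simp_all add: free_ext_def letter_val_def)

text \<open>Replacing generators by letters over distinct generators, possibly inverted, creates no
  new cancellation; reduced words map letter by letter to reduced words of the same length.\<close>

lemma free_ext_letters_eq_Nil:
  fixes \<sigma> :: "'a \<Rightarrow> 'b letter"
  assumes w: "w \<in> carrier (free_group S)" and f: "\<And>s. s \<in> S \<Longrightarrow> f s = [\<sigma> s]"
    and T: "fst ` \<sigma> ` S \<subseteq> T" and inj: "inj_on (fst \<circ> \<sigma>) S"
    and Nil: "free_ext (free_group T) f w = []"
  shows "w = []"
proof -
  define \<tau> where "\<tau> l = (if snd l then \<sigma> (fst l) else flip (\<sigma> (fst l)))" for l
  have "free_ext (free_group T) f w = map \<tau> w \<and> reduced (map \<tau> w)"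
    using w
  proof (induction w)
    case (Cons l w)
    note l = Cons_in_free_group[OF Cons.prems]
    have val: "letter_val (free_group T) f l = [\<tau> l]"
      using f[OF l(1)] T l(1) inv_singleton_free_group[of "\<sigma> (fst l)" T]
      by (simp add: letter_val_def \<tau>_def image_subset_iff)
    have "reduced (map \<tau> (l # w))"
    proof (cases w)
      case (Cons k v)
      have "k \<noteq> flip l" "fst k \<in> S"
        using Cons.prems Cons by (auto simp: carrier_free_group reduced_Cons)
      \<comment> \<open>Cancelling images have the same underlying generator, so by injectivity
        \<open>k\<close> and \<open>l\<close> do too. As \<open>k\<close> is not
        \<open>flip l\<close>, it is \<open>l\<close>, but no letter is its own inverse.\<close>
      have "\<tau> k \<noteq> flip (\<tau> l)"
      proof
        assume eq: "\<tau> k = flip (\<tau> l)"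
        then have "fst (\<tau> k) = fst (\<tau> l)" by simp
        then have "fst (\<sigma> (fst k)) = fst (\<sigma> (fst l))"
          by (simp add: \<tau>_def split: if_splits)
        then have "fst k = fst l"
          using inj_onD[OF inj, of "fst k" "fst l"] l(1) \<open>fst k \<in> S\<close> by simp
        with \<open>k \<noteq> flip l\<close> have "k = l"
          by (simp add: flip_def prod_eq_iff)
        with eq have "snd (\<tau> l) = snd (flip (\<tau> l))" by simp
        then show False by (simp add: flip_def)
      qed
      then show ?thesis
        using Cons Cons.IH l(2) by (simp add: reduced_Cons)
    qed (simp add: reduced_Cons)
    then show ?case
      using val Cons.IH l(2) by (simp add: free_ext_def mult_free_group normalize_word_reduced)
  qed (simp add: free_ext_def one_free_group)
  then show ?thesis using Nil by simp
qed


section \<open>Recognizing free and free abelian subgroups\<close>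

text \<open>With \<open>m_assoc\<close>, these cancel adjacent inverses inside right-nested
  products.\<close>

lemma (in group)
  assumes "x \<in> carrier G" "y \<in> carrier G"
  shows inv_mult_cancel_left: "inv x \<otimes> (x \<otimes> y) = y"
    and mult_inv_cancel_left: "x \<otimes> (inv x \<otimes> y) = y"
  using assms by (simp_all flip: m_assoc)

lemma (in group) conj_eq_imp_commute:
  assumes "x \<in> carrier G" "y \<in> carrier G" "x \<otimes> y \<otimes> inv x = y"
  shows "x \<otimes> y = y \<otimes> x"
  using assms by (metis inv_solve_right m_closed)

text \<open>\<open>?H\<close> evaluates a formal word in the elements of \<open>S\<close> inside
  \<open>G\<close>. Its image is the generated subgroup, so a trivial kernel makes it an
  isomorphism.\<close>

lemma (in group) subgroup_generated_iso_free_group: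
  fixes S :: "'a set"
  assumes S: "S \<subseteq> carrier G"
    and ker: "\<And>w. w \<in> carrier (free_group S) \<Longrightarrow> free_ext G (\<lambda>s. s) w = \<one> \<Longrightarrow> w = []"
  shows "subgroup_generated G S \<cong> free_group S"
proof -
  let ?H = "free_ext G (\<lambda>s. s)"
  have id: "(\<lambda>s. s) \<in> S \<rightarrow> carrier G" using S by auto
  interpret F: group "free_group S" by (rule group_free_group)
  interpret H: group_hom "free_group S" G ?H
    by unfold_locales (rule free_ext_hom[OF id])
  have gen: "carrier (subgroup_generated G S) = generate G S"
    using S by (simp add: carrier_subgroup_generated Int_absorb1)
  have "?H w \<in> generate G S" if "w \<in> carrier (free_group S)" for w
    using that
  proof (induction rule: free_group_induct)
    case one
    then show ?case using H.hom_one generate.one[of G S] by (simp add: one_free_group)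
  next
    case (gen x)
    then show ?case using subsetD[OF S, of x] by (simp add: free_ext_free_gen generate.incl)
  next
    case (mult u v)
    then show ?case by (simp add: generate.eng)
  next
    case (inv u)
    then show ?case using S by (simp add: H.hom_inv generate_m_inv_closed)
  qed
  moreover have "generate G S \<subseteq> ?H ` carrier (free_group S)"
  proof (rule generate_subgroup_incl[OF _ H.img_is_subgroup])
    show "S \<subseteq> ?H ` carrier (free_group S)"
    proof
      fix s assume "s \<in> S"
      then have "?H (free_gen s) = s" using subsetD[OF S, of s] by (simp add: free_ext_free_gen)
      then show "s \<in> ?H ` carrier (free_group S)"
        using \<open>s \<in> S\<close> by (metis free_gen_in_carrier image_eqI)
    qed
  qed
  ultimately have img: "?H ` carrier (free_group S) = carrier (subgroup_generated G S)"
    unfolding gen by blast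
  moreover have "inj_on ?H (carrier (free_group S))"
    using ker by (simp add: H.inj_on_one_iff one_free_group)
  ultimately have "?H \<in> iso (free_group S) (subgroup_generated G S)"
    by (auto simp: iso_def bij_betw_def hom_def)
  then show ?thesis
    using F.iso_sym by (auto simp: is_iso_def)
qed

lemma (in group) int_pow_commutes:
  assumes "x \<otimes> y = y \<otimes> x" "x \<in> carrier G" "y \<in> carrier G"
  shows "x [^] (m :: int) \<otimes> y = y \<otimes> x [^] m"
proof (cases m)
  case (nonneg k)
  then show ?thesis using assms by (simp add: int_pow_int group_commutes_pow)
next
  case (neg k)
  have "x [^] Suc k \<otimes> y = y \<otimes> x [^] Suc k"
    using assms by (intro group_commutes_pow)
  moreover define z where "z = x [^] Suc k"
  ultimately have zy: "z \<otimes> y = y \<otimes> z" and z: "z \<in> carrier G"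
    using assms by auto
  \<comment> \<open>A negative power is the inverse of a positive power \<open>z\<close>; the
    relation for \<open>z\<close> is multiplied by \<open>inv z\<close> on both sides.\<close>
  have "inv z \<otimes> y = inv z \<otimes> (y \<otimes> z) \<otimes> inv z"
    using z assms by (simp add: m_assoc)
  also have "\<dots> = y \<otimes> inv z"
    unfolding zy[symmetric] using z assms by (simp add: inv_mult_cancel_left)
  finally show ?thesis
    using assms neg z_def by (simp only: int_pow_neg_int)
qed

lemma (in group) subgroup_generated_iso_free_Abelian_group:
  assumes ab: "a \<in> carrier G" "b \<in> carrier G" "a \<noteq> b" and comm: "a \<otimes> b = b \<otimes> a"
    and indep: "\<And>(k :: int) (l :: int). a [^] k \<otimes> b [^] l = \<one> \<Longrightarrow> k = 0 \<and> l = 0"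
  shows "subgroup_generated G {a, b} \<cong> free_Abelian_group {a, b}"
proof -
  let ?Z = "free_Abelian_group {a, b}"
  \<comment> \<open>Elements of \<open>?Z\<close> are finitely supported integer functions;
    \<open>h\<close> reads their values as exponents.\<close>
  define h where "h c = a [^] Poly_Mapping.lookup c a \<otimes> b [^] Poly_Mapping.lookup c b" for c :: "'a \<Rightarrow>\<^sub>0 int"
  have comm_pow: "a [^] k \<otimes> b [^] l = b [^] l \<otimes> a [^] k" for k l :: int
    using int_pow_commutes[OF int_pow_commutes[OF comm[symmetric], symmetric]] ab by simp
  interpret Z: group ?Z by simp
  have "h \<in> hom ?Z G"
  proof (rule homI)
    fix c d
    have "b [^] l \<otimes> (a [^] k \<otimes> z) = a [^] k \<otimes> (b [^] l \<otimes> z)" if "z \<in> carrier G" for z and k l :: int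
      using that ab comm_pow[of k l] by (simp flip: m_assoc)
    then show "h (c \<otimes>\<^bsub>?Z\<^esub> d) = h c \<otimes> h d"
      using ab by (simp add: h_def lookup_add int_pow_mult m_assoc)
  qed (use ab in \<open>simp add: h_def\<close>)
  then interpret h: group_hom ?Z G h by unfold_locales
  have gen: "carrier (subgroup_generated G {a, b}) = generate G {a, b}"
    using ab by (simp add: carrier_subgroup_generated)
  have "subgroup (generate G {a, b}) G"
    using ab by (intro generate_is_subgroup) auto
  then interpret g: subgroup "generate G {a, b}" G .
  have "a [^] k \<in> generate G {a, b}" "b [^] k \<in> generate G {a, b}" for k :: int
    using g.subgroup_axioms by (auto intro!: subgroup_int_pow_closed intro: generate.incl)
  then have "h ` carrier ?Z \<subseteq> generate G {a, b}"
    by (auto simp: h_def)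
  moreover have "generate G {a, b} \<subseteq> h ` carrier ?Z"
  proof (rule generate_subgroup_incl[OF _ h.img_is_subgroup])
    \<comment> \<open>Here \<open>a \<noteq> b\<close> makes the other exponent vanish.\<close>
    have "h (frag_of a) = a" "h (frag_of b) = b"
      using ab by (auto simp: h_def lookup_single)
    then show "{a, b} \<subseteq> h ` carrier ?Z"
      by (metis empty_subsetI frag_of_in_free_Abelian_group image_eqI insertI1 insertI2 insert_subset)
  qed
  ultimately have "h ` carrier ?Z = carrier (subgroup_generated G {a, b})"
    unfolding gen by blast
  moreover have "inj_on h (carrier ?Z)"
  proof -
    have "c = 0" if "Poly_Mapping.keys c \<subseteq> {a, b}" "h c = \<one>" for c
    proof (rule poly_mapping_eqI)
      fix x show "Poly_Mapping.lookup c x = Poly_Mapping.lookup 0 x"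
        using that indep[of "Poly_Mapping.lookup c a" "Poly_Mapping.lookup c b"]
        by (cases "x \<in> {a, b}") (auto simp: h_def in_keys_iff)
    qed
    then show ?thesis by (simp add: h.inj_on_one_iff)
  qed
  ultimately have "h \<in> iso ?Z (subgroup_generated G {a, b})"
    using h.homh by (auto simp: iso_def bij_betw_def hom_def)
  then show ?thesis
    using Z.iso_sym by (auto simp: is_iso_def)
qed

section \<open>Evaluation and equality of elements of \<open>IA n\<close>\<close>

lemma
  assumes \<phi>: "\<phi> \<in> carrier (IA n)"
  shows IA_hom: "\<phi> \<in> hom (F_X n) (F_X n)"
    and IA_mult: "\<And>\<psi> z. \<psi> \<in> carrier (IA n) \<Longrightarrow> z \<in> carrier (F_X n) \<Longrightarrow> (\<phi> \<otimes>\<^bsub>IA n\<^esub> \<psi>) z = \<phi> (\<psi> z)"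
    and IA_one: "\<And>z. z \<in> carrier (F_X n) \<Longrightarrow> \<one>\<^bsub>IA n\<^esub> z = z"
    and IA_eqI: "\<And>\<psi>. \<psi> \<in> carrier (IA n) \<Longrightarrow>
      (\<And>k. k \<in> {1..n} \<Longrightarrow> \<phi> (free_gen k) = \<psi> (free_gen k)) \<Longrightarrow> \<phi> = \<psi>"
proof -
  have auto: "\<psi> \<in> auto (F_X n)" if "\<psi> \<in> carrier (IA n)" for \<psi>
    using that by (simp add: IA_def)
  have autoD: "\<psi> \<in> hom (F_X n) (F_X n)" "\<psi> \<in> Bij (carrier (F_X n))"
    if "\<psi> \<in> carrier (IA n)" for \<psi>
    using auto[OF that] unfolding auto_def by blast+
  show "\<phi> \<in> hom (F_X n) (F_X n)"
    by (rule autoD[OF \<phi>])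
  show "(\<phi> \<otimes>\<^bsub>IA n\<^esub> \<psi>) z = \<phi> (\<psi> z)" if "\<psi> \<in> carrier (IA n)" "z \<in> carrier (F_X n)" for \<psi> z
  proof -
    have "\<phi> \<otimes>\<^bsub>IA n\<^esub> \<psi> = compose (carrier (F_X n)) \<phi> \<psi>"
      using autoD(2)[OF \<phi>] autoD(2)[OF that(1)]
      unfolding IA_def AutoGroup_def BijGroup_def by simp
    then show ?thesis using that(2) by (simp add: compose_def)
  qed
  show "\<one>\<^bsub>IA n\<^esub> z = z" if "z \<in> carrier (F_X n)" for z
    using that unfolding IA_def AutoGroup_def BijGroup_def by simp
  fix \<psi> assume \<psi>: "\<psi> \<in> carrier (IA n)"
    and eq: "\<And>k. k \<in> {1..n} \<Longrightarrow> \<phi> (free_gen k) = \<psi> (free_gen k)"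
  show "\<phi> = \<psi>"
  \<comment> \<open>Both maps are extensional, so agreement on the carrier suffices, and there
    homomorphisms are determined by the generators.\<close>
  proof (rule extensionalityI)
    show "\<phi> \<in> extensional (carrier (F_X n))" "\<psi> \<in> extensional (carrier (F_X n))"
      using autoD(2)[OF \<phi>] autoD(2)[OF \<psi>] unfolding Bij_def by blast+
    show "\<phi> z = \<psi> z" if "z \<in> carrier (F_X n)" for z
      using group.free_group_hom_eq[OF group_free_group autoD(1)[OF \<phi>] autoD(1)[OF \<psi>] eq that] .
  qed
qed

section \<open>Automorphisms acting by conjugation on a free factor\<close>

text \<open>Keeps \<open>{1..n}\<close> from being rewritten to \<open>{Suc 0..n}\<close>.\<close>

declare One_nat_def [simp del]

text \<open>On \<open>F(P)\<close>, \<open>\<phi>\<close> is conjugation by \<open>c\<close>. The image of \<open>x\<^sub>k\<close> is parametrized so that not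
  only \<open>c\<close> but also \<open>v\<close> is multiplicative in \<open>\<phi>\<close>; the conjugator \<open>c v\<^sup>-\<^sup>1\<close> itself is only a crossed
  homomorphism.\<close>

definition acts_by_conj ::
  "nat \<Rightarrow> nat set \<Rightarrow> nat \<Rightarrow> (nat letter list \<Rightarrow> nat letter list) \<Rightarrow> nat letter list \<Rightarrow> nat letter list \<Rightarrow> bool"
where
  "acts_by_conj n P k \<phi> c v \<longleftrightarrow> \<phi> \<in> carrier (IA n) \<and>
     c \<in> carrier (free_group P) \<and> v \<in> carrier (free_group P) \<and>
     (\<forall>z \<in> carrier (free_group P). \<phi> z = c \<otimes>\<^bsub>F_X n\<^esub> z \<otimes>\<^bsub>F_X n\<^esub> inv\<^bsub>F_X n\<^esub> c) \<and>
     \<phi> (free_gen k) = c \<otimes>\<^bsub>F_X n\<^esub> inv\<^bsub>F_X n\<^esub> v \<otimes>\<^bsub>F_X n\<^esub> free_gen k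
       \<otimes>\<^bsub>F_X n\<^esub> v \<otimes>\<^bsub>F_X n\<^esub> inv\<^bsub>F_X n\<^esub> c"

section \<open>Multiplicativity of the conjugating data\<close>

context
  fixes n k :: nat and P :: "nat set"
  assumes P: "P \<subseteq> {1..n}" and k: "k \<in> {1..n}"
begin

interpretation F: group "F_X n" by (rule group_free_group)
interpretation A: group "IA n" by (rule group_IA)
interpretation P: subgroup "carrier (free_group P)" "F_X n" by (rule subgroup_free_group[OF P])

lemma acts_by_conj_one: "acts_by_conj n P k \<one>\<^bsub>IA n\<^esub> \<one>\<^bsub>F_X n\<^esub> \<one>\<^bsub>F_X n\<^esub>"
  using k P.subset by (auto simp: acts_by_conj_def IA_one[OF A.one_closed] free_gen_in_carrier)

text \<open>Since \<open>d\<close> and \<open>u\<close> lie in the free group on \<open>P\<close>,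
  \<open>\<phi>\<close> conjugates them by \<open>c\<close>. Applying \<open>\<phi>\<close> to
  \<open>d u^-1 x_k u d^-1\<close> therefore gives \<open>c d u^-1 v^-1 x_k v u d^-1 c^-1\<close>,
  where the inner factors \<open>c^-1 c\<close> have cancelled.\<close>

lemma acts_by_conj_mult:
  assumes \<phi>: "acts_by_conj n P k \<phi> c v" and \<psi>: "acts_by_conj n P k \<psi> d u"
  shows "acts_by_conj n P k (\<phi> \<otimes>\<^bsub>IA n\<^esub> \<psi>) (c \<otimes>\<^bsub>F_X n\<^esub> d) (v \<otimes>\<^bsub>F_X n\<^esub> u)"
proof -
  have A: "\<phi> \<in> carrier (IA n)" "\<psi> \<in> carrier (IA n)"
    and cl: "c \<in> carrier (free_group P)" "d \<in> carrier (free_group P)"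
      "v \<in> carrier (free_group P)" "u \<in> carrier (free_group P)"
    and conj: "\<And>z. z \<in> carrier (free_group P) \<Longrightarrow> \<phi> z = c \<otimes>\<^bsub>F_X n\<^esub> z \<otimes>\<^bsub>F_X n\<^esub> inv\<^bsub>F_X n\<^esub> c"
    using assms by (auto simp: acts_by_conj_def)
  interpret \<phi>: group_hom "F_X n" "F_X n" \<phi> by unfold_locales (rule IA_hom[OF A(1)])
  note [simp] = P.mem_carrier free_gen_in_carrier[OF k] cl
  have "(\<phi> \<otimes>\<^bsub>IA n\<^esub> \<psi>) z = c \<otimes>\<^bsub>F_X n\<^esub> d \<otimes>\<^bsub>F_X n\<^esub> z \<otimes>\<^bsub>F_X n\<^esub> inv\<^bsub>F_X n\<^esub> (c \<otimes>\<^bsub>F_X n\<^esub> d)"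
    if "z \<in> carrier (free_group P)" for z
    using that \<psi> A
    by (simp add: acts_by_conj_def IA_mult conj F.m_assoc F.inv_mult_group
        F.inv_mult_cancel_left F.mult_inv_cancel_left)
  moreover have "(\<phi> \<otimes>\<^bsub>IA n\<^esub> \<psi>) (free_gen k) = c \<otimes>\<^bsub>F_X n\<^esub> d \<otimes>\<^bsub>F_X n\<^esub> inv\<^bsub>F_X n\<^esub> (v \<otimes>\<^bsub>F_X n\<^esub> u)
      \<otimes>\<^bsub>F_X n\<^esub> free_gen k \<otimes>\<^bsub>F_X n\<^esub> (v \<otimes>\<^bsub>F_X n\<^esub> u) \<otimes>\<^bsub>F_X n\<^esub> inv\<^bsub>F_X n\<^esub> (c \<otimes>\<^bsub>F_X n\<^esub> d)"
  proof -
    have "\<phi> (free_gen k) = c \<otimes>\<^bsub>F_X n\<^esub> inv\<^bsub>F_X n\<^esub> v \<otimes>\<^bsub>F_X n\<^esub> free_gen k \<otimes>\<^bsub>F_X n\<^esub> v \<otimes>\<^bsub>F_X n\<^esub> inv\<^bsub>F_X n\<^esub> c"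
      "\<psi> (free_gen k) = d \<otimes>\<^bsub>F_X n\<^esub> inv\<^bsub>F_X n\<^esub> u \<otimes>\<^bsub>F_X n\<^esub> free_gen k \<otimes>\<^bsub>F_X n\<^esub> u \<otimes>\<^bsub>F_X n\<^esub> inv\<^bsub>F_X n\<^esub> d"
      using assms by (auto simp: acts_by_conj_def)
    then show ?thesis
      using A by (simp add: IA_mult conj \<phi>.hom_inv F.m_assoc F.inv_mult_group
          F.inv_mult_cancel_left F.mult_inv_cancel_left)
  qed
  ultimately show ?thesis
    using A cl by (simp add: acts_by_conj_def)
qed

lemma acts_by_conj_inv:
  assumes \<phi>: "acts_by_conj n P k \<phi> c v"
  shows "acts_by_conj n P k (inv\<^bsub>IA n\<^esub> \<phi>) (inv\<^bsub>F_X n\<^esub> c) (inv\<^bsub>F_X n\<^esub> v)"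
proof -
  have A: "\<phi> \<in> carrier (IA n)" "inv\<^bsub>IA n\<^esub> \<phi> \<in> carrier (IA n)"
    and cl: "c \<in> carrier (free_group P)" "v \<in> carrier (free_group P)"
    and conj: "\<And>z. z \<in> carrier (free_group P) \<Longrightarrow> \<phi> z = c \<otimes>\<^bsub>F_X n\<^esub> z \<otimes>\<^bsub>F_X n\<^esub> inv\<^bsub>F_X n\<^esub> c"
    and xk: "\<phi> (free_gen k) = c \<otimes>\<^bsub>F_X n\<^esub> inv\<^bsub>F_X n\<^esub> v \<otimes>\<^bsub>F_X n\<^esub> free_gen k \<otimes>\<^bsub>F_X n\<^esub> v \<otimes>\<^bsub>F_X n\<^esub> inv\<^bsub>F_X n\<^esub> c"
    using assms by (auto simp: acts_by_conj_def)
  interpret \<phi>: group_hom "F_X n" "F_X n" \<phi> by unfold_locales (rule IA_hom[OF A(1)])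
  note [simp] = P.mem_carrier free_gen_in_carrier[OF k] cl
  \<comment> \<open>The inverse is computed by exhibiting preimages under
    \<open>\<phi>\<close>.\<close>
  have inv: "(inv\<^bsub>IA n\<^esub> \<phi>) z = y" if "\<phi> y = z" "y \<in> carrier (F_X n)" for y z
    using that A IA_mult[OF A(2) A(1), of y] IA_one[OF A(1)] by (simp add: A.l_inv)
  have "(inv\<^bsub>IA n\<^esub> \<phi>) z = inv\<^bsub>F_X n\<^esub> c \<otimes>\<^bsub>F_X n\<^esub> z \<otimes>\<^bsub>F_X n\<^esub> inv\<^bsub>F_X n\<^esub> (inv\<^bsub>F_X n\<^esub> c)"
    if "z \<in> carrier (free_group P)" for z
    using that by (intro inv)
      (simp_all add: conj F.m_assoc F.inv_mult_cancel_left F.mult_inv_cancel_left)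
  moreover have "(inv\<^bsub>IA n\<^esub> \<phi>) (free_gen k) = inv\<^bsub>F_X n\<^esub> c \<otimes>\<^bsub>F_X n\<^esub> inv\<^bsub>F_X n\<^esub> (inv\<^bsub>F_X n\<^esub> v)
      \<otimes>\<^bsub>F_X n\<^esub> free_gen k \<otimes>\<^bsub>F_X n\<^esub> inv\<^bsub>F_X n\<^esub> v \<otimes>\<^bsub>F_X n\<^esub> inv\<^bsub>F_X n\<^esub> (inv\<^bsub>F_X n\<^esub> c)"
    by (intro inv)
      (simp_all add: conj xk F.m_assoc F.inv_mult_cancel_left F.mult_inv_cancel_left)
  ultimately show ?thesis
    using A cl by (simp add: acts_by_conj_def)
qed

text \<open>Multiplicativity reduces the action of every word to that of the generators in
  \<open>S\<close>; both conjugating words become values of homomorphisms.\<close>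

lemma acts_by_conj_free_ext:
  assumes S: "\<And>s. s \<in> S \<Longrightarrow> acts_by_conj n P k s (c s) (v s)"
    and w: "w \<in> carrier (free_group S)"
  shows "acts_by_conj n P k (free_ext (IA n) (\<lambda>s. s) w) (free_ext (F_X n) c w) (free_ext (F_X n) v w)"
proof -
  have f: "(\<lambda>s. s) \<in> S \<rightarrow> carrier (IA n)" "c \<in> S \<rightarrow> carrier (F_X n)" "v \<in> S \<rightarrow> carrier (F_X n)"
    using S P.subset by (auto simp: acts_by_conj_def)
  interpret S: group "free_group S" by (rule group_free_group)
  interpret H: group_hom "free_group S" "IA n" "free_ext (IA n) (\<lambda>s. s)"
    by unfold_locales (rule A.free_ext_hom[OF f(1)])
  interpret c: group_hom "free_group S" "F_X n" "free_ext (F_X n) c"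
    by unfold_locales (rule F.free_ext_hom[OF f(2)])
  interpret v: group_hom "free_group S" "F_X n" "free_ext (F_X n) v"
    by unfold_locales (rule F.free_ext_hom[OF f(3)])
  show ?thesis using w
  proof (induction rule: free_group_induct)
    case one
    then show ?case using acts_by_conj_one by (simp add: free_ext_def)
  next
    case (gen x)
    then show ?case using S[OF gen] f
      by (simp add: A.free_ext_free_gen F.free_ext_free_gen Pi_iff)
  next
    case (mult u v)
    then show ?case by (simp add: acts_by_conj_mult)
  next
    case (inv u)
    then show ?case by (simp add: acts_by_conj_inv H.hom_inv c.hom_inv v.hom_inv)
  qed
qed

text \<open>\<open>\<phi>\<close> and conjugation by \<open>c\<close> are homomorphisms on the free
  group on \<open>P\<close>, so comparing them on the basis is enough.\<close>

lemma acts_by_conjI: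
  assumes \<phi>: "\<phi> \<in> carrier (IA n)"
    and cl: "c \<in> carrier (free_group P)" "v \<in> carrier (free_group P)"
    and gen: "\<And>p. p \<in> P \<Longrightarrow> \<phi> (free_gen p) = c \<otimes>\<^bsub>F_X n\<^esub> free_gen p \<otimes>\<^bsub>F_X n\<^esub> inv\<^bsub>F_X n\<^esub> c"
    and xk: "\<phi> (free_gen k) = c \<otimes>\<^bsub>F_X n\<^esub> inv\<^bsub>F_X n\<^esub> v \<otimes>\<^bsub>F_X n\<^esub> free_gen k
       \<otimes>\<^bsub>F_X n\<^esub> v \<otimes>\<^bsub>F_X n\<^esub> inv\<^bsub>F_X n\<^esub> c"
  shows "acts_by_conj n P k \<phi> c v"
proof -
  interpret \<phi>: group_hom "F_X n" "F_X n" \<phi> by unfold_locales (rule IA_hom[OF \<phi>])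
  have mult: "u \<otimes>\<^bsub>free_group P\<^esub> w = u \<otimes>\<^bsub>F_X n\<^esub> w" for u w
    by (simp add: mult_free_group)
  have "\<phi> \<in> hom (free_group P) (F_X n)"
    by (rule homI) (simp_all add: mult P.mem_carrier)
  moreover have "(\<lambda>z. c \<otimes>\<^bsub>F_X n\<^esub> z \<otimes>\<^bsub>F_X n\<^esub> inv\<^bsub>F_X n\<^esub> c) \<in> hom (free_group P) (F_X n)"
    by (rule homI) (simp_all add: mult P.mem_carrier cl F.m_assoc F.inv_mult_cancel_left)
  ultimately have "\<phi> z = c \<otimes>\<^bsub>F_X n\<^esub> z \<otimes>\<^bsub>F_X n\<^esub> inv\<^bsub>F_X n\<^esub> c" if "z \<in> carrier (free_group P)" for z
    by (rule F.free_group_hom_eq[OF _ _ _ that]) (use gen in auto)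
  then show ?thesis using \<phi> cl xk by (simp add: acts_by_conj_def)
qed

lemma acts_by_conj_one_commutes:
  assumes "acts_by_conj n P k \<one>\<^bsub>IA n\<^esub> c v"
  shows "\<And>p. p \<in> P \<Longrightarrow> c \<otimes>\<^bsub>F_X n\<^esub> free_gen p = free_gen p \<otimes>\<^bsub>F_X n\<^esub> c"
    and "c = [] \<Longrightarrow> v \<otimes>\<^bsub>F_X n\<^esub> free_gen k = free_gen k \<otimes>\<^bsub>F_X n\<^esub> v"
proof -
  note [simp] = P.mem_carrier free_gen_in_carrier[OF k]
  have cl: "c \<in> carrier (free_group P)" "v \<in> carrier (free_group P)"
    using assms by (auto simp: acts_by_conj_def)
  show "c \<otimes>\<^bsub>F_X n\<^esub> free_gen p = free_gen p \<otimes>\<^bsub>F_X n\<^esub> c" if "p \<in> P" for p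
  proof (rule F.conj_eq_imp_commute)
    have p: "free_gen p \<in> carrier (free_group P)" using that by (rule free_gen_in_carrier)
    then show "c \<otimes>\<^bsub>F_X n\<^esub> free_gen p \<otimes>\<^bsub>F_X n\<^esub> inv\<^bsub>F_X n\<^esub> c = free_gen p"
      using assms IA_one[OF A.one_closed, of "free_gen p"] by (simp add: acts_by_conj_def)
    show "free_gen p \<in> carrier (F_X n)" using p by simp
  qed (use cl in simp)
  show "v \<otimes>\<^bsub>F_X n\<^esub> free_gen k = free_gen k \<otimes>\<^bsub>F_X n\<^esub> v" if "c = []"
  proof -
    have "c = \<one>\<^bsub>F_X n\<^esub>" using that by (simp add: one_free_group)
    then have "free_gen k = inv\<^bsub>F_X n\<^esub> v \<otimes>\<^bsub>F_X n\<^esub> free_gen k \<otimes>\<^bsub>F_X n\<^esub> v"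
      using assms cl IA_one[OF A.one_closed, of "free_gen k"] by (simp add: acts_by_conj_def)
    then have "v \<otimes>\<^bsub>F_X n\<^esub> free_gen k = v \<otimes>\<^bsub>F_X n\<^esub> (inv\<^bsub>F_X n\<^esub> v \<otimes>\<^bsub>F_X n\<^esub> free_gen k \<otimes>\<^bsub>F_X n\<^esub> v)"
      by simp
    also have "\<dots> = free_gen k \<otimes>\<^bsub>F_X n\<^esub> v"
      using cl by (simp add: F.m_assoc F.mult_inv_cancel_left)
    finally show ?thesis .
  qed
qed

end

text \<open>A nonempty \<open>c\<close> commuting with \<open>x_p\<close> and \<open>x_q\<close>
  would have to begin with a letter over both. Once \<open>c\<close> is trivial, \<open>v\<close>
  commutes with \<open>x_k\<close> but has letters over \<open>P\<close> only.\<close>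

lemma acts_by_conj_one_Nil:
  assumes P: "P \<subseteq> {1..n}" and k: "k \<in> {1..n}"
    and acts: "acts_by_conj n P k \<one>\<^bsub>IA n\<^esub> c v"
    and pq: "p \<in> P" "q \<in> P" "p \<noteq> q"
  shows "c = []" and "k \<notin> P \<Longrightarrow> v = []"
proof -
  note comm = acts_by_conj_one_commutes[OF P k acts]
  have cl: "c \<in> carrier (free_group P)" "v \<in> carrier (free_group P)"
    using acts unfolding acts_by_conj_def by blast+
  show c: "c = []"
  proof (rule ccontr)
    assume "c \<noteq> []"
    from hd_of_free_gen_centralizer[OF cl(1) this comm(1)] have "fst (hd c) = r" if "r \<in> P" for r
      using that by blast
    from this[OF pq(1)] this[OF pq(2)] pq(3) show False by simp
  qed
  show "v = []" if "k \<notin> P"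
    using free_gen_centralizer_Nil[OF cl(2) that comm(2)[OF c]] .
qed

section \<open>Pairs of generators\<close>

lemma chi_same_source_iso_free_group:
  assumes "i \<in> {1..n}" "j \<in> {1..n}" "i \<noteq> j" "j' \<in> {1..n}" "i \<noteq> j'" "j \<noteq> j'"
    and ne: "chi n i j \<noteq> chi n i j'"
  shows "subgroup_generated (IA n) {chi n i j, chi n i j'} \<cong> free_group {chi n i j, chi n i j'}"
proof (rule group.subgroup_generated_iso_free_group[OF group_IA])
  let ?a = "chi n i j" and ?b = "chi n i j'" and ?P = "{j, j'}"
  let ?S = "{?a, ?b}"
  interpret F: group "F_X n" by (rule group_free_group)
  note fg = free_gen_in_carrier[of _ "{1..n}"] free_gen_in_carrier[of _ ?P]
  show "?S \<subseteq> carrier (IA n)" using assms by (simp add: chi_in_IA)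
  fix w assume w: "w \<in> carrier (free_group ?S)" and ker: "free_ext (IA n) (\<lambda>s. s) w = \<one>\<^bsub>IA n\<^esub>"
  \<comment> \<open>Both automorphisms fix \<open>x_j\<close> and \<open>x_j'\<close>, so the common
    conjugator is trivial; \<open>v s\<close> is read off from the image \<open>v^-1 x_i v\<close>
    of \<open>x_i\<close>.\<close>
  define v where "v s = free_gen (if s = ?a then j else j')" for s
  have P: "?P \<subseteq> {1..n}" using assms by simp
  have one: "\<one>\<^bsub>F_X n\<^esub> \<in> carrier (free_group ?P)"
    using subgroup.one_closed[OF subgroup_free_group[OF P]] .
  have "acts_by_conj n ?P i s \<one>\<^bsub>F_X n\<^esub> (v s)" if "s \<in> ?S" for s
    by (rule acts_by_conjI[OF P assms(1)])
      (use that assms in \<open>auto simp: fg one v_def chi_in_IA chi_same chi_other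
        F.m_assoc F.inv_mult_cancel_left F.mult_inv_cancel_left\<close>)
  note ext = acts_by_conj_free_ext[OF P assms(1) this w]
  have "free_ext (F_X n) v w = []"
    using acts_by_conj_one_Nil(2)[OF P assms(1) ext[unfolded ker], of j j'] assms by simp
  then show "w = []"
    by (rule free_ext_letters_eq_Nil[where f = v and T = "{1..n}" and
          \<sigma> = "\<lambda>s. (if s = ?a then j else j', True)", OF w, rotated -1])
      (use assms ne in \<open>auto simp: v_def free_gen_def\<close>)
qed

lemma chi_swapped_iso_free_group:
  assumes "i \<in> {1..n}" "j \<in> {1..n}" "i \<noteq> j"
    and ne: "chi n i j \<noteq> chi n j i"
  shows "subgroup_generated (IA n) {chi n i j, chi n j i} \<cong> free_group {chi n i j, chi n j i}"
proof (rule group.subgroup_generated_iso_free_group[OF group_IA])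
  let ?a = "chi n i j" and ?b = "chi n j i" and ?P = "{i, j}"
  let ?S = "{?a, ?b}"
  interpret F: group "F_X n" by (rule group_free_group)
  note fg = free_gen_in_carrier[of _ "{1..n}"] free_gen_in_carrier[of _ ?P]
  show "?S \<subseteq> carrier (IA n)" using assms by (simp add: chi_in_IA)
  fix w assume w: "w \<in> carrier (free_group ?S)" and ker: "free_ext (IA n) (\<lambda>s. s) w = \<one>\<^bsub>IA n\<^esub>"
  \<comment> \<open>Conjugation by \<open>x_j^-1\<close> fixes \<open>x_j\<close> and acts on
    \<open>x_i\<close> as \<open>?a\<close>; symmetrically for \<open>?b\<close>. The extra index is
    \<open>i\<close>, already in \<open>?P\<close>, where \<open>v = 1\<close> agrees with this
    conjugation.\<close>
  define c where "c s = inv\<^bsub>F_X n\<^esub> (free_gen (if s = ?a then j else i))" for s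
  have P: "?P \<subseteq> {1..n}" using assms by simp
  note sub = subgroup.one_closed[OF subgroup_free_group[OF P]]
    subgroup.m_inv_closed[OF subgroup_free_group[OF P]]
  have "acts_by_conj n ?P i s (c s) \<one>\<^bsub>F_X n\<^esub>" if "s \<in> ?S" for s
    by (rule acts_by_conjI[OF P assms(1)])
      (use that assms in \<open>auto simp: fg sub c_def chi_in_IA chi_same chi_other
        F.m_assoc F.inv_mult_cancel_left F.mult_inv_cancel_left\<close>)
  note ext = acts_by_conj_free_ext[OF P assms(1) this w]
  have "free_ext (F_X n) c w = []"
    using acts_by_conj_one_Nil(1)[OF P assms(1) ext[unfolded ker], of i j] assms by simp
  then show "w = []"
    by (rule free_ext_letters_eq_Nil[where f = c and T = "{1..n}" and
          \<sigma> = "\<lambda>s. (if s = ?a then j else i, False)", OF w, rotated -1])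
      (use assms ne in \<open>auto simp: c_def inv_free_gen\<close>)
qed

lemma chi_chain_iso_free_group:
  assumes "i \<in> {1..n}" "j \<in> {1..n}" "i \<noteq> j" "k \<in> {1..n}" "k \<noteq> i" "k \<noteq> j"
    and ne: "chi n i j \<noteq> chi n k i"
  shows "subgroup_generated (IA n) {chi n i j, chi n k i} \<cong> free_group {chi n i j, chi n k i}"
proof (rule group.subgroup_generated_iso_free_group[OF group_IA])
  let ?a = "chi n i j" and ?b = "chi n k i" and ?P = "{i, j}"
  let ?S = "{?a, ?b}"
  interpret F: group "F_X n" by (rule group_free_group)
  note fg = free_gen_in_carrier[of _ "{1..n}"] free_gen_in_carrier[of _ ?P]
  show "?S \<subseteq> carrier (IA n)" using assms by (simp add: chi_in_IA)
  fix w assume w: "w \<in> carrier (free_group ?S)" and ker: "free_ext (IA n) (\<lambda>s. s) w = \<one>\<^bsub>IA n\<^esub>"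
  \<comment> \<open>\<open>?a\<close> conjugates by \<open>x_j^-1\<close> on the free group on
    \<open>?P\<close> but fixes \<open>x_k\<close>, which suggests \<open>v = c\<close>.
    \<open>?b\<close> fixes that free group and sends \<open>x_k\<close> to
    \<open>x_i^-1 x_k x_i\<close>, whence \<open>c = 1\<close> and \<open>v = x_i\<close>.\<close>
  define c where "c s = (if s = ?a then inv\<^bsub>F_X n\<^esub> (free_gen j) else \<one>\<^bsub>F_X n\<^esub>)" for s
  define v where "v s = (if s = ?a then inv\<^bsub>F_X n\<^esub> (free_gen j) else free_gen i)" for s
  have P: "?P \<subseteq> {1..n}" using assms by simp
  note sub = subgroup.one_closed[OF subgroup_free_group[OF P]]
    subgroup.m_inv_closed[OF subgroup_free_group[OF P]]
  have "acts_by_conj n ?P k ?a (c ?a) (v ?a)"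
    by (rule acts_by_conjI[OF P assms(4)])
      (use assms in \<open>auto simp: fg sub c_def v_def chi_in_IA chi_same chi_other F.m_assoc
        F.inv_mult_cancel_left F.mult_inv_cancel_left\<close>)
  moreover have "acts_by_conj n ?P k ?b (c ?b) (v ?b)"
    by (rule acts_by_conjI[OF P assms(4)])
      (use assms in \<open>auto simp: fg sub c_def v_def chi_in_IA chi_same chi_other F.m_assoc\<close>)
  ultimately have "acts_by_conj n ?P k s (c s) (v s)" if "s \<in> ?S" for s
    using that by blast
  note ext = acts_by_conj_free_ext[OF P assms(4) this w]
  have "free_ext (F_X n) v w = []"
    using acts_by_conj_one_Nil(2)[OF P assms(4) ext[unfolded ker], of i j] assms by simp
  then show "w = []"
    by (rule free_ext_letters_eq_Nil[where f = v and T = "{1..n}" and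
          \<sigma> = "\<lambda>s. if s = ?a then (j, False) else (i, True)", OF w, rotated -1])
      (use assms ne in \<open>auto simp: v_def inv_free_gen free_gen_def[of i]\<close>)
qed

text \<open>\<open>chi n i' j'\<close> fixes both \<open>x_i\<close> and \<open>x_j\<close>, so the
  product conjugates \<open>x_i\<close> by a power of \<open>x_j\<close> with exponent
  \<open>r\<close> up to sign. If it is trivial, that power commutes with \<open>x_i\<close> and
  must be empty.\<close>

lemma chi_power_independent:
  assumes "i \<in> {1..n}" "j \<in> {1..n}" "i \<noteq> j" "i' \<in> {1..n}" "j' \<in> {1..n}" "i' \<noteq> j'"
    and "i' \<noteq> i" "i' \<noteq> j" "chi n i j \<noteq> chi n i' j'"
    and eq: "chi n i j [^]\<^bsub>IA n\<^esub> (r :: int) \<otimes>\<^bsub>IA n\<^esub> chi n i' j' [^]\<^bsub>IA n\<^esub> (s :: int) = \<one>\<^bsub>IA n\<^esub>"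
  shows "r = 0"
proof -
  let ?a = "chi n i j" and ?b = "chi n i' j'" and ?P = "{j}"
  let ?S = "{?a, ?b}"
  interpret F: group "F_X n" by (rule group_free_group)
  interpret A: group "IA n" by (rule group_IA)
  interpret S: group "free_group ?S" by (rule group_free_group)
  note fg = free_gen_in_carrier[of _ "{1..n}"] free_gen_in_carrier[of _ ?P] free_gen_in_carrier[of _ ?S]
  define v where "v s = (if s = ?a then free_gen j else \<one>\<^bsub>F_X n\<^esub>)" for s
  define w where "w = free_gen ?a [^]\<^bsub>free_group ?S\<^esub> r \<otimes>\<^bsub>free_group ?S\<^esub> free_gen ?b [^]\<^bsub>free_group ?S\<^esub> s"
  have w: "w \<in> carrier (free_group ?S)"
    by (simp add: w_def fg)
  have P: "?P \<subseteq> {1..n}" using assms(1-9) by simp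
  note one = subgroup.one_closed[OF subgroup_free_group[OF P]]
  have "acts_by_conj n ?P i s \<one>\<^bsub>F_X n\<^esub> (v s)" if "s \<in> ?S" for s
    by (rule acts_by_conjI[OF P assms(1)])
      (use that assms(1-9) in \<open>auto simp: fg one v_def chi_in_IA chi_same chi_other
        F.m_assoc F.inv_mult_cancel_left F.mult_inv_cancel_left\<close>)
  note ext = acts_by_conj_free_ext[OF P assms(1) this w]
  have H: "(\<lambda>s. s) \<in> ?S \<rightarrow> carrier (IA n)" and V: "v \<in> ?S \<rightarrow> carrier (F_X n)"
    using assms(1-9) by (simp_all add: chi_in_IA v_def fg)
  \<comment> \<open>Stated for any target group, since \<open>w\<close> is evaluated both in
    \<open>IA n\<close> and in \<open>F_X n\<close>.\<close>
  have val: "h w = h (free_gen ?a) [^]\<^bsub>G\<^esub> r \<otimes>\<^bsub>G\<^esub> h (free_gen ?b) [^]\<^bsub>G\<^esub> s"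
    if "h \<in> hom (free_group ?S) G" "group G" for h and G :: "('z, 'y) monoid_scheme"
  proof -
    interpret h: group_hom "free_group ?S" G h
      using that by (simp add: group_hom_def group_hom_axioms_def S.group_axioms)
    show ?thesis by (simp add: w_def fg h.hom_int_pow)
  qed
  have "free_ext (IA n) (\<lambda>s. s) w = \<one>\<^bsub>IA n\<^esub>"
    unfolding val[OF A.free_ext_hom[OF H] A.group_axioms]
    using assms(1-9) by (simp add: A.free_ext_free_gen chi_in_IA eq)
  \<comment> \<open>With a single index in \<open>?P\<close>, triviality of \<open>c\<close> cannot
    come from two commutation relations; it holds because every generator has conjugator
    \<open>1\<close>.\<close>
  then have comm: "free_ext (F_X n) v w \<otimes>\<^bsub>F_X n\<^esub> free_gen i = free_gen i \<otimes>\<^bsub>F_X n\<^esub> free_ext (F_X n) v w"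
    using acts_by_conj_one_commutes(2)[OF P assms(1)] ext[unfolded F.free_ext_one]
    by (simp add: one_free_group)
  have "free_ext (F_X n) v w \<in> carrier (free_group ?P)"
    using ext by (simp add: acts_by_conj_def)
  then have "free_ext (F_X n) v w = []"
    by (rule free_gen_centralizer_Nil[OF _ _ comm]) (use assms(3) in simp)
  moreover have "free_ext (F_X n) v w = free_gen j [^]\<^bsub>F_X n\<^esub> r"
    unfolding val[OF F.free_ext_hom[OF V] F.group_axioms]
    using assms(1-9) by (simp add: F.free_ext_free_gen v_def fg)
  ultimately have "free_gen j [^]\<^bsub>F_X n\<^esub> r = []"
    by simp
  then show "r = 0"
    by (rule free_gen_int_pow_eq_Nil[OF assms(2)])
qed

lemma chi_pair_iso_free_Abelian_group:
  assumes "i \<in> {1..n}" "j \<in> {1..n}" "i \<noteq> j" "i' \<in> {1..n}" "j' \<in> {1..n}" "i' \<noteq> j'"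
    and "i \<noteq> i'" "i' \<noteq> j" "i \<noteq> j'" and ne: "chi n i j \<noteq> chi n i' j'"
  shows "subgroup_generated (IA n) {chi n i j, chi n i' j'} \<cong>
    free_Abelian_group {chi n i j, chi n i' j'}"
proof -
  let ?a = "chi n i j" and ?b = "chi n i' j'"
  interpret F: group "F_X n" by (rule group_free_group)
  interpret A: group "IA n" by (rule group_IA)
  have in_IA: "?a \<in> carrier (IA n)" "?b \<in> carrier (IA n)"
    using assms by (simp_all add: chi_in_IA)
  interpret a: group_hom "F_X n" "F_X n" ?a by unfold_locales (rule IA_hom[OF in_IA(1)])
  interpret b: group_hom "F_X n" "F_X n" ?b by unfold_locales (rule IA_hom[OF in_IA(2)])
  note fg = free_gen_in_carrier[of _ "{1..n}"]
  have comm: "?a \<otimes>\<^bsub>IA n\<^esub> ?b = ?b \<otimes>\<^bsub>IA n\<^esub> ?a"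
  proof (rule IA_eqI)
    fix k assume k: "k \<in> {1..n}"
    have a: "?a (free_gen k) = free_gen k" if "k \<in> {i', j, j'}" for k
      by (rule chi_other) (use that assms in auto)
    have b: "?b (free_gen k) = free_gen k" if "k \<in> {i, j, j'}" for k
      by (rule chi_other) (use that assms in auto)
    consider "k = i" | "k = i'" | "k \<noteq> i" "k \<noteq> i'" by blast
    then have "?a (?b (free_gen k)) = ?b (?a (free_gen k))"
    proof cases
      case 1
      then show ?thesis
        using assms(1-3) a b by (simp add: chi_same fg b.hom_inv)
    next
      case 2
      then show ?thesis
        using assms(4-6) a b by (simp add: chi_same fg a.hom_inv)
    next
      case 3
      then show ?thesis
        using chi_other[OF assms(1-3) k] chi_other[OF assms(4-6) k] by simp
    qed
    then show "(?a \<otimes>\<^bsub>IA n\<^esub> ?b) (free_gen k) = (?b \<otimes>\<^bsub>IA n\<^esub> ?a) (free_gen k)"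
      using IA_mult[OF in_IA(1) in_IA(2) fg[OF k]] IA_mult[OF in_IA(2) in_IA(1) fg[OF k]] by simp
  qed (use in_IA in simp_all)
  show ?thesis
  proof (rule A.subgroup_generated_iso_free_Abelian_group[OF in_IA ne comm])
    fix r s :: int assume eq: "?a [^]\<^bsub>IA n\<^esub> r \<otimes>\<^bsub>IA n\<^esub> ?b [^]\<^bsub>IA n\<^esub> s = \<one>\<^bsub>IA n\<^esub>"
    \<comment> \<open>\<open>chi_power_independent\<close> yields only the exponent of the first
      factor, so the relation is also read in the opposite order.\<close>
    then have eq': "?b [^]\<^bsub>IA n\<^esub> s \<otimes>\<^bsub>IA n\<^esub> ?a [^]\<^bsub>IA n\<^esub> r = \<one>\<^bsub>IA n\<^esub>"
      by (rule A.inv_comm) (use in_IA in simp_all)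
    have "s = 0"
      by (rule chi_power_independent[OF assms(4-6) assms(1-3) _ _ ne[symmetric] eq']) (use assms in auto)
    moreover have "r = 0"
      by (rule chi_power_independent[OF assms(1-6) _ _ ne eq]) (use assms in auto)
    ultimately show "r = 0 \<and> s = 0" by simp
  qed
qed

theorem theorem3p11:
  fixes n i j i' j' :: nat
  assumes "i \<in> {1..n}" "j \<in> {1..n}" "i \<noteq> j"
    and "i' \<in> {1..n}" "j' \<in> {1..n}" "i' \<noteq> j'"
    and "chi n i j \<noteq> chi n i' j'"
  shows "({i, j} \<inter> {i', j'} = {} \<or> (j = j' \<and> i \<noteq> i') \<longrightarrow>
            is_free_abelian_group (subgroup_generated (IA n) {chi n i j, chi n i' j'}))
       \<and> (\<not> ({i, j} \<inter> {i', j'} = {} \<or> (j = j' \<and> i \<noteq> i')) \<longrightarrow>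
            is_free_group (subgroup_generated (IA n) {chi n i j, chi n i' j'}))"
proof (intro conjI impI)
  assume "{i, j} \<inter> {i', j'} = {} \<or> (j = j' \<and> i \<noteq> i')"
  \<comment> \<open>In both alternatives neither automorphism moves a generator occurring in the
    other; the targets may coincide.\<close>
  then have "i \<noteq> i'" "i' \<noteq> j" "i \<noteq> j'" using assms by auto
  then show "is_free_abelian_group (subgroup_generated (IA n) {chi n i j, chi n i' j'})"
    using chi_pair_iso_free_Abelian_group[OF assms(1-6) _ _ _ assms(7)]
    unfolding is_free_abelian_group_def by blast
next
  let ?S = "{chi n i j, chi n i' j'}"
  assume "\<not> ({i, j} \<inter> {i', j'} = {} \<or> (j = j' \<and> i \<noteq> i'))"
  \<comment> \<open>The remaining pairs share a source, are swapped, or form a chain in one of two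
    directions. Distinctness of the automorphisms gives \<open>j \<noteq> j'\<close> when the
    sources agree.\<close>
  then consider "i = i'" "j \<noteq> j'" | "i = j'" "j = i'" | "i = j'" "i' \<noteq> i" "i' \<noteq> j"
    | "j = i'" "j' \<noteq> i" "j' \<noteq> j"
    using assms by auto
  then have "subgroup_generated (IA n) ?S \<cong> free_group ?S"
  proof cases
    case 1
    then show ?thesis using chi_same_source_iso_free_group assms by simp
  next
    case 2
    then show ?thesis using chi_swapped_iso_free_group assms by simp
  next
    case 3
    then show ?thesis using chi_chain_iso_free_group[OF assms(1-3,4)] assms by simp
  next
    case 4
    then have "subgroup_generated (IA n) {chi n i' j', chi n i j} \<cong> free_group {chi n i' j', chi n i j}"
      using chi_chain_iso_free_group[OF assms(4-6,1)] assms by simp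
    then show ?thesis by (simp only: insert_commute)
  qed
  then show "is_free_group (subgroup_generated (IA n) ?S)"
    unfolding is_free_group_def by blast
qed

end
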